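(* Let $f \in \mathcal{G}$. Then $\operatorname{Part} f$ is decidable if and only if $f$ is effectively conjugate to its normal form $f'$ (i.e. $f'$ is recursive and there is $h \in \mathcal{G}$ with $f = h^{-1} f' h$). Moreover, a decider for $\operatorname{Part} f$ can be computed from (a program for) $f'$.
   Context: $\mathcal{G}$ denotes the group of recursive permutations of $\mathbb{N}$. For a permutation $f$, $[x]_f = \{f^k(x): k\in\mathbb{Z}\}$ is its cycle containing $x$ and $\operatorname{Part} f = \{[x]_f : x \in \mathbb{N}\}$; $\operatorname{Part} f$ is decidable if there is a total recursive function deciding, for all $x,x'$, whether $x' \in [x]_f$. Let $\delta:\mathbb{Z}\to\mathbb{N}$ be the bijection $\delta(0)=0$, $\delta(k) = 2k$ for $k>0$, $\delta(k) = -2k-1$ for $k<0$. A cycle of a permutation $f$ of length $n \in \mathbb{N}^+ \cup\{\infty\}$ with least element $a_0$ is in normal form if $j \mapsto f^{\delta^{-1}(j)}(a_0)$ is strictly increasing for $0 \le j < n$; a permutation is normal if all its cycles are in normal form. For every permutation $f$ there is exactly one (possibly non-recursive) normal permutation $f'$ with $\operatorname{Part} f' = \operatorname{Part} f$, called the normal form of $f$. Effective conjugacy means conjugacy via an element of $\mathcal{G}$. *)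

theory Defs
  imports "HOL-Library.Nat_Bijection" "HOL-Library.Extended_Nat"
begin

datatype recf =
    Zero
  | Succ
  | Proj nat
  | Comp recf "recf list"
  | PrimRec recf recf
  | Mu recf

text \<open>
  Programs carry no arity annotation: applied to argument lists of a fixed length \<open>n\<close>, each of
  them denotes an \<open>n\<close>-ary partial recursive function (the nowhere defined one if an index is out of
  range). The recursion variable and the search variable are the first argument.
  In the clause for \<open>Mu\<close>, unbounded search succeeds only if all values tested before the first zero
  are defined.
\<close>

fun run :: "recf \<Rightarrow> nat list \<Rightarrow> nat option" where
  "run Zero xs = Some 0"
| "run Succ xs = (case xs of [] \<Rightarrow> None | x # _ \<Rightarrow> Some (Suc x))"
| "run (Proj i) xs = (if i < length xs then Some (xs ! i) else None)"
| "run (Comp f gs) xs =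
    (let ys = map (\<lambda>g. run g xs) gs
     in if None \<in> set ys then None else run f (map the ys))"
| "run (PrimRec f g) xs =
    (case xs of
       [] \<Rightarrow> None
     | n # zs \<Rightarrow>
         rec_nat (run f zs) (\<lambda>m r. Option.bind r (\<lambda>v. run g (m # v # zs))) n)"
| "run (Mu f) xs =
    (if \<exists>n. run f (n # xs) = Some 0 \<and> (\<forall>m<n. run f (m # xs) \<noteq> None)
     then Some (LEAST n. run f (n # xs) = Some 0)
     else None)"

definition computes :: "recf \<Rightarrow> (nat \<Rightarrow> nat) \<Rightarrow> bool" where
  "computes p f \<longleftrightarrow> (\<forall>x. run p [x] = Some (f x))"

definition recursive :: "(nat \<Rightarrow> nat) \<Rightarrow> bool" where
  "recursive f \<longleftrightarrow> (\<exists>p. computes p f)"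

fun goedel_number :: "recf \<Rightarrow> nat" where
  "goedel_number Zero = prod_encode (0, 0)"
| "goedel_number Succ = prod_encode (1, 0)"
| "goedel_number (Proj i) = prod_encode (2, i)"
| "goedel_number (Comp f gs) = prod_encode (3, prod_encode (goedel_number f, list_encode (map goedel_number gs)))"
| "goedel_number (PrimRec f g) = prod_encode (4, prod_encode (goedel_number f, goedel_number g))"
| "goedel_number (Mu f) = prod_encode (5, goedel_number f)"

lemma goedel_number_eq_iff: "goedel_number p = goedel_number q \<longleftrightarrow> p = q"
proof
  show "goedel_number p = goedel_number q \<Longrightarrow> p = q"
  proof (induction p arbitrary: q)
    case (Comp f gs)
    then obtain f' gs' where q: "q = Comp f' gs'" and "goedel_number f = goedel_number f'"
      and eq: "map goedel_number gs = map goedel_number gs'"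
      by (cases q) (auto simp: list_encode_eq)
    moreover have "gs = gs'"
      using eq Comp.IH(2)
      by (auto simp: list_eq_iff_nth_eq dest: map_eq_imp_length_eq)
    ultimately show ?case
      using Comp.IH(1) by simp
  qed (case_tac q; auto)+
qed simp

definition rec_perms :: "(nat \<Rightarrow> nat) set" where
  "rec_perms = {f. bij f \<and> recursive f}"

definition perm_power :: "('a \<Rightarrow> 'a) \<Rightarrow> int \<Rightarrow> 'a \<Rightarrow> 'a" where
  "perm_power f k = (if k \<ge> 0 then f ^^ nat k else inv f ^^ nat (- k))"

definition cycle :: "('a \<Rightarrow> 'a) \<Rightarrow> 'a \<Rightarrow> 'a set" where
  "cycle f x = {perm_power f k x | k. True}"

definition Part :: "('a \<Rightarrow> 'a) \<Rightarrow> 'a set set" where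
  "Part f = range (cycle f)"

definition decides_Part :: "recf \<Rightarrow> (nat \<Rightarrow> nat) \<Rightarrow> bool" where
  "decides_Part p f \<longleftrightarrow>
    (\<forall>x x'. run p [x, x'] = Some (if x' \<in> cycle f x then 1 else 0))"

definition decidable_Part :: "(nat \<Rightarrow> nat) \<Rightarrow> bool" where
  "decidable_Part f \<longleftrightarrow> (\<exists>p. decides_Part p f)"

definition delta :: "int \<Rightarrow> nat" where
  "delta k = (if k \<ge> 0 then nat (2 * k) else nat (- 2 * k - 1))"

lemma bij_delta: "bij delta"
proof (rule bijI)
  show "inj delta"
  proof (rule injI)
    have int_delta: "int (delta k) = (if k \<ge> 0 then 2 * k else - 2 * k - 1)" for k
      by (simp add: delta_def)
    fix x y assume "delta x = delta y"
    then have "int (delta x) = int (delta y)" by simp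
    then show "x = y" unfolding int_delta by presburger
  qed
  have "n = delta (if even n then int (n div 2) else - int (n div 2) - 1)" for n
    by (auto simp: delta_def elim!: oddE)
  then show "surj delta"
    by (rule surjI[OF sym])
qed

definition cycle_length :: "'a set \<Rightarrow> enat" where
  "cycle_length C = (if finite C then enat (card C) else \<infinity>)"

definition cycle_in_normal_form :: "(nat \<Rightarrow> nat) \<Rightarrow> nat set \<Rightarrow> bool" where
  "cycle_in_normal_form f C \<longleftrightarrow>
    strict_mono_on {j. enat j < cycle_length C}
      (\<lambda>j. perm_power f (inv delta j) (LEAST a. a \<in> C))"

definition normal :: "(nat \<Rightarrow> nat) \<Rightarrow> bool" where
  "normal f \<longleftrightarrow> bij f \<and> (\<forall>C\<in>Part f. cycle_in_normal_form f C)"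

definition normal_form :: "(nat \<Rightarrow> nat) \<Rightarrow> nat \<Rightarrow> nat" where
  "normal_form f = (THE f'. normal f' \<and> Part f' = Part f)"

definition effectively_conjugate :: "(nat \<Rightarrow> nat) \<Rightarrow> (nat \<Rightarrow> nat) \<Rightarrow> bool" where
  "effectively_conjugate f g \<longleftrightarrow> (\<exists>h\<in>rec_perms. f = inv h \<circ> g \<circ> h)"

end

theory Submission
  imports Defs
begin

text \<open>
  Enumerate a cycle of length \<open>n\<close> with least element \<open>a\<close> as \<open>e j = f\<^sup>k a\<close> with \<open>\<delta> k = j < n\<close>.
  Whatever \<open>f\<close> is, it acts on the indices \<open>j\<close> by the same permutation, which depends on \<open>n\<close> only. So
  the normal form is obtained by letting this permutation act on the ranks in the cycle, and
  sending \<open>e j\<close> to the element of rank \<open>j\<close> conjugates \<open>f\<close> to it. Ranks are computable from a decider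
  for \<open>Part f\<close>, and so is \<open>k < n\<close>, which says that \<open>f\<^sup>i a \<noteq> a\<close> for \<open>0 < i \<le> k\<close>.

  Conversely, if \<open>g\<close> is normal, then every element of a cycle except the least one is larger than one
  of its neighbours \<open>g x\<close> and \<open>g\<^sup>-\<^sup>1 x\<close>. Iterating \<open>x \<mapsto> min {x, g x, g\<^sup>-\<^sup>1 x}\<close> thus reaches the least
  element of the cycle in at most \<open>x\<close> steps, and two elements are in the same cycle iff these least
  elements agree. The decider contains a program for \<open>g\<close> as a subprogram, and its Goedel number
  is an explicit function of the Goedel number of this program.
\<close>

section \<open>Uniformly recursive functionals\<close>

text \<open>Programs with a hole: \<open>p\<close> is the program to be plugged in.\<close>

inductive template :: "(recf \<Rightarrow> recf) \<Rightarrow> bool" where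
  hole: "template (\<lambda>p. p)"
| const: "template (\<lambda>_. q)"
| comp: "template A \<Longrightarrow> (\<forall>B\<in>set Bs. template B) \<Longrightarrow> template (\<lambda>p. Comp (A p) (map (\<lambda>B. B p) Bs))"
| prim_rec: "template A \<Longrightarrow> template B \<Longrightarrow> template (\<lambda>p. PrimRec (A p) (B p))"
| mu: "template A \<Longrightarrow> template (\<lambda>p. Mu (A p))"

text \<open>A single template has to work for all oracles \<open>\<phi> \<in> D\<close> and all programs for them. With \<open>D = {f}\<close>
  for a recursive \<open>f\<close> this is ordinary recursiveness.\<close>

definition urec :: "(nat \<Rightarrow> nat) set \<Rightarrow> nat \<Rightarrow> ((nat \<Rightarrow> nat) \<Rightarrow> nat list \<Rightarrow> nat) \<Rightarrow> bool" where
  "urec D n F \<longleftrightarrow> (\<exists>T. template T \<and> (\<forall>\<phi>\<in>D. \<forall>p. computes p \<phi> \<longrightarrow>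
     (\<forall>xs. length xs = n \<longrightarrow> run (T p) xs = Some (F \<phi> xs))))"

section \<open>Closure under substitution, primitive recursion and unbounded search\<close>

lemma urecI:
  assumes "template T"
    and "\<And>\<phi> p xs. \<phi> \<in> D \<Longrightarrow> computes p \<phi> \<Longrightarrow> length xs = n \<Longrightarrow> run (T p) xs = Some (F \<phi> xs)"
  shows "urec D n F"
  using assms unfolding urec_def by blast

lemma urec_cong:
  assumes "urec D n F"
    and "\<And>\<phi> xs. \<phi> \<in> D \<Longrightarrow> length xs = n \<Longrightarrow> F \<phi> xs = G \<phi> xs"
  shows "urec D n G"
  using assms unfolding urec_def by fastforce

text \<open>The constant template does not consult the oracle; fixed programs, such as a given
  decider, enter this way.\<close>

lemma urec_program:
  assumes "\<And>xs. length xs = n \<Longrightarrow> run q xs = Some (F xs)"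
  shows "urec D n (\<lambda>_. F)"
  using assms by (intro urecI[OF template.const[of q]]) auto

lemma urec_nth: "i < n \<Longrightarrow> urec D n (\<lambda>\<phi> xs. xs ! i)"
  by (rule urec_program[of _ "Proj i"]) auto

lemma urec_comp:
  assumes F: "urec D (length Gs) F" and G: "\<And>G. G \<in> set Gs \<Longrightarrow> urec D n G"
  shows "urec D n (\<lambda>\<phi> xs. F \<phi> (map (\<lambda>G. G \<phi> xs) Gs))"
proof -
  obtain A where A: "template A" "\<And>\<phi> p xs. \<phi> \<in> D \<Longrightarrow> computes p \<phi> \<Longrightarrow> length xs = length Gs
    \<Longrightarrow> run (A p) xs = Some (F \<phi> xs)"
    using F unfolding urec_def by blast
  have "\<forall>G\<in>set Gs. \<exists>T. template T \<and> (\<forall>\<phi>\<in>D. \<forall>p. computes p \<phi> \<longrightarrow>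
     (\<forall>xs. length xs = n \<longrightarrow> run (T p) xs = Some (G \<phi> xs)))"
    using G unfolding urec_def by blast
  then obtain t where t: "\<forall>G\<in>set Gs. template (t G) \<and> (\<forall>\<phi>\<in>D. \<forall>p. computes p \<phi> \<longrightarrow>
     (\<forall>xs. length xs = n \<longrightarrow> run (t G p) xs = Some (G \<phi> xs)))"
    by metis
  show ?thesis
  proof (rule urecI[OF template.comp[OF A(1), of "map t Gs"]])
    show "\<forall>B\<in>set (map t Gs). template B" using t by auto
    fix \<phi> p and xs :: "nat list"
    assume *: "\<phi> \<in> D" "computes p \<phi>" "length xs = n"
    have "run (t G p) xs = Some (G \<phi> xs)" if "G \<in> set Gs" for G
      using t * that by blast
    moreover from this have "map (\<lambda>G. the (run (t G p) xs)) Gs = map (\<lambda>G. G \<phi> xs) Gs"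
      by simp
    ultimately show "run (Comp (A p) (map (\<lambda>B. B p) (map t Gs))) xs = Some (F \<phi> (map (\<lambda>G. G \<phi> xs) Gs))"
      using A(2)[OF *(1,2), of "map (\<lambda>G. G \<phi> xs) Gs"] by (auto simp: Let_def comp_def cong: map_cong)
  qed
qed

lemma urec_unary:
  assumes "urec D 1 (\<lambda>\<phi> zs. b \<phi> (zs ! 0))" "urec D n A"
  shows "urec D n (\<lambda>\<phi> xs. b \<phi> (A \<phi> xs))"
  using urec_comp[of D "[A]" "\<lambda>\<phi> zs. b \<phi> (zs ! 0)" n] assms by simp

lemma urec_binary:
  assumes "urec D 2 (\<lambda>\<phi> zs. b \<phi> (zs ! 0) (zs ! 1))" "urec D n A" "urec D n B"
  shows "urec D n (\<lambda>\<phi> xs. b \<phi> (A \<phi> xs) (B \<phi> xs))"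
  using urec_comp[of D "[A, B]" "\<lambda>\<phi> zs. b \<phi> (zs ! 0) (zs ! 1)" n] assms
  by (auto simp: numeral_2_eq_2)

lemma urec_Suc: "urec D n A \<Longrightarrow> urec D n (\<lambda>\<phi> xs. Suc (A \<phi> xs))"
  by (rule urec_unary[where b="\<lambda>_. Suc"], rule urec_program[of _ Succ])
     (auto simp: length_Suc_conv)

lemma urec_const: "urec D n (\<lambda>\<phi> xs. c)"
proof (induction c)
  case 0
  show ?case by (rule urec_program[of _ Zero]) auto
qed (rule urec_Suc)

lemma urec_oracle: "urec D n A \<Longrightarrow> urec D n (\<lambda>\<phi> xs. \<phi> (A \<phi> xs))"
  by (rule urec_unary[where b="\<lambda>\<phi> x. \<phi> x"], rule urecI[OF template.hole])
     (auto simp: length_Suc_conv computes_def)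

text \<open>Weakening by composition with projections: under a recursion or a search, the
  environment is preceded by \<open>k\<close> bound variables.\<close>

lemma urec_drop:
  assumes "urec D m A" "n = m + k"
  shows "urec D n (\<lambda>\<phi> zs. A \<phi> (drop k zs))"
proof -
  have "urec D n (\<lambda>\<phi> xs. A \<phi> (map (\<lambda>G. G \<phi> xs) (map (\<lambda>i \<phi> xs. xs ! i) [k..<n])))"
    using assms by (intro urec_comp) (auto intro!: urec_nth)
  then show ?thesis
    by (rule urec_cong) (auto simp: assms(2) comp_def intro!: arg_cong[of _ _ "A _"] nth_equalityI)
qed

lemma urec_nth_drop: "i + k < n \<Longrightarrow> urec D n (\<lambda>\<phi> xs. drop k xs ! i)"
  by (rule urec_cong[OF urec_nth[of "k + i"]]) auto

text \<open>The bodies of recursion and minimization see the environment \<open>xs\<close> as a tail of their own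
  argument list; stated this way, the premises are higher-order patterns.\<close>

lemma urec_rec_nat:
  assumes K: "urec D n K" and A: "urec D n A"
    and B: "urec D (Suc (Suc n)) (\<lambda>\<phi> zs. b \<phi> (zs ! 0) (zs ! 1) (drop 2 zs))"
  shows "urec D n (\<lambda>\<phi> xs. rec_nat (A \<phi> xs) (\<lambda>m v. b \<phi> m v xs) (K \<phi> xs))"
proof -
  obtain S where S: "template S" "\<And>\<phi> p xs. \<phi> \<in> D \<Longrightarrow> computes p \<phi> \<Longrightarrow> length xs = n
    \<Longrightarrow> run (S p) xs = Some (A \<phi> xs)"
    using A unfolding urec_def by blast
  obtain T where T: "template T" "\<And>\<phi> p xs. \<phi> \<in> D \<Longrightarrow> computes p \<phi> \<Longrightarrow> length xs = Suc (Suc n)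
    \<Longrightarrow> run (T p) xs = Some (b \<phi> (xs ! 0) (xs ! 1) (drop 2 xs))"
    using B unfolding urec_def by blast
  \<comment> \<open>\<open>PrimRec\<close> takes its counter as first argument; afterwards
    \<open>K\<close> is substituted for it and projections restore the environment.\<close>
  define R where "R \<phi> zs = rec_nat (A \<phi> (tl zs)) (\<lambda>m v. b \<phi> m v (tl zs)) (hd zs)" for \<phi> zs
  have "urec D (Suc n) R"
  proof (rule urecI[OF template.prim_rec[OF S(1) T(1)]])
    fix \<phi> p and zs :: "nat list"
    assume *: "\<phi> \<in> D" "computes p \<phi>" "length zs = Suc n"
    then obtain k xs where zs: "zs = k # xs" "length xs = n"
      by (auto simp: length_Suc_conv)
    have "rec_nat (run (S p) xs) (\<lambda>m r. Option.bind r (\<lambda>v. run (T p) (m # v # xs))) k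
      = Some (rec_nat (A \<phi> xs) (\<lambda>m v. b \<phi> m v xs) k)"
      by (induction k) (use * zs S(2) T(2) in auto)
    then show "run (PrimRec (S p) (T p)) zs = Some (R \<phi> zs)"
      by (simp add: zs R_def)
  qed
  then have "urec D n (\<lambda>\<phi> xs. R \<phi> (map (\<lambda>G. G \<phi> xs) (K # map (\<lambda>i \<phi> xs. xs ! i) [0..<n])))"
    using K by (intro urec_comp) (auto intro!: urec_nth)
  then show ?thesis
    by (rule urec_cong) (auto simp: R_def comp_def map_nth)
qed

lemma urec_Least_zero:
  assumes F: "urec D (Suc n) (\<lambda>\<phi> zs. b \<phi> (zs ! 0) (drop 1 zs))"
    and ex: "\<And>\<phi> xs. \<phi> \<in> D \<Longrightarrow> length xs = n \<Longrightarrow> \<exists>y. b \<phi> y xs = 0"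
  shows "urec D n (\<lambda>\<phi> xs. LEAST y. b \<phi> y xs = 0)"
proof -
  obtain T where T: "template T" "\<And>\<phi> p xs. \<phi> \<in> D \<Longrightarrow> computes p \<phi> \<Longrightarrow> length xs = Suc n
    \<Longrightarrow> run (T p) xs = Some (b \<phi> (xs ! 0) (drop 1 xs))"
    using F unfolding urec_def by blast
  show ?thesis
  proof (rule urecI[OF template.mu[OF T(1)]])
    fix \<phi> p and xs :: "nat list"
    assume *: "\<phi> \<in> D" "computes p \<phi>" "length xs = n"
    \<comment> \<open>All tested values are defined, so the search succeeds as soon as a zero
      exists.\<close>
    have "run (T p) (y # xs) = Some (b \<phi> y xs)" for y
      using T(2)[OF *(1,2), of "y # xs"] *(3) by simp
    then show "run (Mu (T p)) xs = Some (LEAST y. b \<phi> y xs = 0)"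
      using ex[OF *(1,3)] by simp
  qed
qed

section \<open>Arithmetic, logical operations, bounded quantification and pairing\<close>

lemma urec_add:
  assumes "urec D n A" "urec D n B"
  shows "urec D n (\<lambda>\<phi> xs. A \<phi> xs + B \<phi> xs)"
proof (rule urec_binary[where b="\<lambda>_. (+)", OF _ assms])
  have "urec D 2 (\<lambda>\<phi> zs. rec_nat (zs ! 0) (\<lambda>m v. Suc v) (zs ! 1))"
    by (intro urec_rec_nat urec_nth urec_Suc) auto
  moreover have "rec_nat a (\<lambda>m v. Suc v) b = a + b" for a b by (induction b) auto
  ultimately show "urec D 2 (\<lambda>\<phi> zs. zs ! 0 + zs ! 1)" by simp
qed

lemma urec_diff:
  assumes "urec D n A" "urec D n B"
  shows "urec D n (\<lambda>\<phi> xs. A \<phi> xs - B \<phi> xs)"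
proof (rule urec_binary[where b="\<lambda>_. (-)", OF _ assms])
  \<comment> \<open>The inner recursion is the predecessor, with value 0 at 0; iterating it yields
    truncated subtraction.\<close>
  have "urec D 2 (\<lambda>\<phi> zs. rec_nat (zs ! 0) (\<lambda>m v. rec_nat 0 (\<lambda>k _. k) v) (zs ! 1))"
    by (intro urec_rec_nat urec_nth urec_const) auto
  moreover have "rec_nat a (\<lambda>m v. rec_nat 0 (\<lambda>k _. k) v) b = a - b" for a b
  proof (induction b)
    case (Suc b)
    then show ?case by (cases "a - b") auto
  qed auto
  ultimately show "urec D 2 (\<lambda>\<phi> zs. zs ! 0 - zs ! 1)" by simp
qed

lemma urec_if:
  assumes "urec D n (\<lambda>\<phi> xs. of_bool (P \<phi> xs))" "urec D n A" "urec D n B"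
  shows "urec D n (\<lambda>\<phi> xs. if P \<phi> xs then A \<phi> xs else B \<phi> xs)"
proof -
  \<comment> \<open>A recursion of length 0 or 1 selects its start value or its step value.\<close>
  have "urec D n (\<lambda>\<phi> xs. rec_nat (B \<phi> xs) (\<lambda>_ _. A \<phi> xs) (of_bool (P \<phi> xs)))"
    by (rule urec_rec_nat[OF assms(1,3)], rule urec_drop[OF assms(2)]) simp
  then show ?thesis by (rule urec_cong) auto
qed

lemma urec_not:
  assumes "urec D n (\<lambda>\<phi> xs. of_bool (P \<phi> xs))"
  shows "urec D n (\<lambda>\<phi> xs. of_bool (\<not> P \<phi> xs))"
  by (rule urec_cong[OF urec_if[OF assms urec_const[of _ _ 0] urec_const[of _ _ 1]]]) auto

lemma urec_conj:
  assumes "urec D n (\<lambda>\<phi> xs. of_bool (P \<phi> xs))" "urec D n (\<lambda>\<phi> xs. of_bool (Q \<phi> xs))"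
  shows "urec D n (\<lambda>\<phi> xs. of_bool (P \<phi> xs \<and> Q \<phi> xs))"
  by (rule urec_cong[OF urec_if[OF assms urec_const[of _ _ 0]]]) auto

lemma urec_eq:
  assumes "urec D n A" "urec D n B"
  shows "urec D n (\<lambda>\<phi> xs. of_bool (A \<phi> xs = B \<phi> xs))"
proof -
  have "urec D n (\<lambda>\<phi> xs. 1 - ((A \<phi> xs - B \<phi> xs) + (B \<phi> xs - A \<phi> xs)))"
    by (intro urec_diff urec_add urec_const assms)
  then show ?thesis by (rule urec_cong) auto
qed

text \<open>Position 0 holds the bound variable and position 1 the accumulator of the recursion, so
  the environment starts at position 2.\<close>

lemma urec_less_all:
  assumes "urec D n K" "urec D (Suc (Suc n)) (\<lambda>\<phi> zs. of_bool (P \<phi> (zs ! 0) (drop 2 zs)))"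
  shows "urec D n (\<lambda>\<phi> xs. of_bool (\<forall>i<K \<phi> xs. P \<phi> i xs))"
proof -
  have "urec D n (\<lambda>\<phi> xs. rec_nat 1 (\<lambda>i v. of_bool (v = 1 \<and> P \<phi> i xs)) (K \<phi> xs))"
    using assms by (intro urec_rec_nat urec_conj urec_eq urec_nth urec_const) auto
  moreover have "rec_nat 1 (\<lambda>i v. of_bool (v = 1 \<and> P \<phi> i xs)) k = (of_bool (\<forall>i<k. P \<phi> i xs) :: nat)"
    for \<phi> k xs
    by (induction k) (auto simp: less_Suc_eq)
  ultimately show ?thesis by simp
qed

lemma urec_Least:
  assumes "urec D (Suc n) (\<lambda>\<phi> zs. of_bool (P \<phi> (zs ! 0) (drop 1 zs)))"
    and "\<And>\<phi> xs. \<phi> \<in> D \<Longrightarrow> length xs = n \<Longrightarrow> \<exists>y. P \<phi> y xs"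
  shows "urec D n (\<lambda>\<phi> xs. LEAST y. P \<phi> y xs)"
  using urec_Least_zero[of D n "\<lambda>\<phi> y xs. of_bool (\<not> P \<phi> y xs)", OF urec_not] assms by simp

lemma urec_funpow:
  assumes "urec D 1 (\<lambda>\<phi> zs. g \<phi> (zs ! 0))" "urec D n K" "urec D n A"
  shows "urec D n (\<lambda>\<phi> xs. (g \<phi> ^^ K \<phi> xs) (A \<phi> xs))"
proof -
  have "urec D n (\<lambda>\<phi> xs. rec_nat (A \<phi> xs) (\<lambda>_ v. g \<phi> v) (K \<phi> xs))"
    by (rule urec_rec_nat[OF assms(2,3)], rule urec_unary[where b=g, OF assms(1)], rule urec_nth) simp
  moreover have "rec_nat a (\<lambda>_ v. g \<phi> v) k = (g \<phi> ^^ k) a" for \<phi> a k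
    by (induction k) auto
  ultimately show ?thesis by simp
qed

lemma urec_parity:
  assumes "urec D n A"
  shows "urec D n (\<lambda>\<phi> xs. of_bool (odd (A \<phi> xs)))"
proof -
  have "urec D n (\<lambda>\<phi> xs. rec_nat 0 (\<lambda>_ v. 1 - v) (A \<phi> xs))"
    using assms by (intro urec_rec_nat urec_diff urec_nth urec_const) auto
  moreover have "rec_nat 0 (\<lambda>_ v. 1 - v) k = (of_bool (odd k) :: nat)" for k
    by (induction k) auto
  ultimately show ?thesis by simp
qed

lemma urec_half:
  assumes "urec D n A"
  shows "urec D n (\<lambda>\<phi> xs. A \<phi> xs div 2)"
proof -
  have "urec D n (\<lambda>\<phi> xs. rec_nat 0 (\<lambda>m v. v + of_bool (odd m)) (A \<phi> xs))"
    using assms by (intro urec_rec_nat urec_add urec_parity urec_nth urec_const) auto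
  moreover have "rec_nat 0 (\<lambda>m v. v + of_bool (odd m)) k = (k div 2 :: nat)" for k
    by (induction k) (auto elim!: oddE)
  ultimately show ?thesis by simp
qed

lemma urec_triangle:
  assumes "urec D n A"
  shows "urec D n (\<lambda>\<phi> xs. triangle (A \<phi> xs))"
proof -
  have "urec D n (\<lambda>\<phi> xs. rec_nat 0 (\<lambda>m v. v + Suc m) (A \<phi> xs))"
    using assms by (intro urec_rec_nat urec_add urec_Suc urec_nth urec_const) auto
  moreover have "rec_nat 0 (\<lambda>m v. v + Suc m) k = triangle k" for k
    by (induction k) auto
  ultimately show ?thesis by simp
qed

lemma urec_prod_encode:
  assumes "urec D n A" "urec D n B"
  shows "urec D n (\<lambda>\<phi> xs. prod_encode (A \<phi> xs, B \<phi> xs))"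
  using assms unfolding prod_encode_def prod.case by (intro urec_add urec_triangle)

text \<open>Plugging the program \<open>p\<close> of the single oracle into the template turns it
  into an ordinary program.\<close>

lemma recursive_iff_urec:
  assumes "computes p \<phi>"
  shows "recursive g \<longleftrightarrow> urec {\<phi>} 1 (\<lambda>_ xs. g (xs ! 0))"
proof
  assume "recursive g"
  then obtain q where "computes q g" unfolding recursive_def by blast
  then show "urec {\<phi>} 1 (\<lambda>_ xs. g (xs ! 0))"
    by (intro urec_program[of _ q]) (auto simp: computes_def length_Suc_conv)
next
  assume "urec {\<phi>} 1 (\<lambda>_ xs. g (xs ! 0))"
  then obtain T where T: "\<And>xs. length xs = 1 \<Longrightarrow> run (T p) xs = Some (g (xs ! 0))"
    using assms unfolding urec_def by blast
  have "run (T p) [x] = Some (g x)" for x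
    using T[of "[x]"] by simp
  then show "recursive g"
    unfolding recursive_def computes_def by blast
qed

text \<open>By induction on the template: the Goedel number of a compound program arises from those
  of its parts by pairing and list coding, so plugging in a program is a recursive operation on
  numbers.\<close>

lemma template_goedel_number:
  assumes "template T"
  shows "\<exists>\<Phi>. recursive \<Phi> \<and> (\<forall>p. \<Phi> (goedel_number p) = goedel_number (T p))"
proof -
  \<comment> \<open>The identity is a dummy oracle that makes the closure rules for
    \<open>urec\<close> available.\<close>
  have id: "computes (Proj 0) (\<lambda>x. x)"
    by (simp add: computes_def)
  have "\<exists>\<Phi>. urec {\<lambda>x. x} 1 (\<lambda>_ xs. \<Phi> (xs ! 0)) \<and> (\<forall>p. \<Phi> (goedel_number p) = goedel_number (T p))"
    using assms
  proof induction
    case hole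
    show ?case by (intro exI[of _ "\<lambda>x. x"] conjI urec_nth) auto
  next
    case (const q)
    show ?case by (intro exI[of _ "\<lambda>_. goedel_number q"] conjI urec_const) auto
  next
    case (comp A Bs)
    then obtain a where a: "urec {\<lambda>x. x} 1 (\<lambda>_ xs. a (xs ! 0))" "\<And>p. a (goedel_number p) = goedel_number (A p)"
      by blast
    from comp(3) have "\<exists>b. urec {\<lambda>x. x} 1 (\<lambda>_ xs. b (xs ! 0)) \<and>
      (\<forall>p. b (goedel_number p) = list_encode (map goedel_number (map (\<lambda>B. B p) Bs)))"
    proof (induction Bs)
      case Nil
      show ?case by (intro exI[of _ "\<lambda>_. 0"] conjI urec_const) auto
    next
      case (Cons B Bs)
      then obtain b c where
        "urec {\<lambda>x. x} 1 (\<lambda>_ xs. b (xs ! 0))"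
        "\<forall>p. b (goedel_number p) = list_encode (map goedel_number (map (\<lambda>B. B p) Bs))"
        "urec {\<lambda>x. x} 1 (\<lambda>_ xs. c (xs ! 0))" "\<forall>p. c (goedel_number p) = goedel_number (B p)"
        by auto
      then show ?case
        by (intro exI[of _ "\<lambda>x. Suc (prod_encode (c x, b x))"] conjI urec_Suc urec_prod_encode) auto
    qed
    then obtain b where b: "urec {\<lambda>x. x} 1 (\<lambda>_ xs. b (xs ! 0))"
      "\<And>p. b (goedel_number p) = list_encode (map goedel_number (map (\<lambda>B. B p) Bs))"
      by blast
    show ?case
      by (intro exI[of _ "\<lambda>x. prod_encode (3, prod_encode (a x, b x))"] conjI urec_prod_encode
          urec_const a b) (simp add: a b)
  next
    case (prim_rec A B)
    then obtain a b where "urec {\<lambda>x. x} 1 (\<lambda>_ xs. a (xs ! 0))" "\<forall>p. a (goedel_number p) = goedel_number (A p)"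
      "urec {\<lambda>x. x} 1 (\<lambda>_ xs. b (xs ! 0))" "\<forall>p. b (goedel_number p) = goedel_number (B p)"
      by blast
    then show ?case
      by (intro exI[of _ "\<lambda>x. prod_encode (4, prod_encode (a x, b x))"] conjI urec_prod_encode
          urec_const) auto
  next
    case (mu A)
    then obtain a where "urec {\<lambda>x. x} 1 (\<lambda>_ xs. a (xs ! 0))" "\<forall>p. a (goedel_number p) = goedel_number (A p)"
      by blast
    then show ?case
      by (intro exI[of _ "\<lambda>x. prod_encode (5, a x)"] conjI urec_prod_encode urec_const) auto
  qed
  then show ?thesis using recursive_iff_urec[OF id] by blast
qed

section \<open>Cycles of permutations\<close>

lemma perm_power_0 [simp]: "perm_power f 0 x = x"
  by (simp add: perm_power_def)

lemma perm_power_of_nat: "perm_power f (int m) x = (f ^^ m) x"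
  by (simp add: perm_power_def)

lemma perm_power_minus_of_nat: "perm_power f (- int m) x = (inv f ^^ m) x"
  by (cases "m = 0") (auto simp: perm_power_def)

lemma perm_power_step:
  assumes "bij f"
  shows "f (perm_power f k x) = perm_power f (k + 1) x"
proof (cases "k \<ge> 0")
  case True
  then obtain m where "k = int m" by (metis nat_0_le)
  moreover have "nat (int m + 1) = Suc m" by simp
  ultimately show ?thesis by (simp add: perm_power_def)
next
  case False
  then have "k = - int (Suc (nat (- k - 1)))" by simp
  then obtain m where k: "k = - int (Suc m)" by blast
  then have "k + 1 = - int m" by simp
  then show ?thesis
    using assms unfolding k by (simp only: perm_power_minus_of_nat) (simp add: bij_is_surj surj_f_inv_f)
qed

lemma perm_power_add:
  assumes "bij f"
  shows "perm_power f (k + l) x = perm_power f k (perm_power f l x)"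
proof (induction k rule: int_induct[where k = 0])
  case (step1 i)
  then show ?case using perm_power_step[OF assms] by (metis ab_semigroup_add_class.add_ac(1) add.commute)
next
  case (step2 i)
  \<comment> \<open>For the downward step, both sides are compared after one application of the
    injective \<open>f\<close>.\<close>
  have "f (perm_power f (i - 1 + l) x) = f (perm_power f (i - 1) (perm_power f l x))"
    using step2 by (simp add: perm_power_step[OF assms] algebra_simps)
  then show ?case using assms by (simp add: bij_is_inj inj_eq)
qed simp

lemma self_in_cycle [simp]: "x \<in> cycle f x"
  unfolding cycle_def using perm_power_0 by (metis (mono_tags, lifting) mem_Collect_eq)

lemma perm_power_in_cycle [simp]: "perm_power f k x \<in> cycle f x"
  unfolding cycle_def by blast

text \<open>The opposite power leads from \<open>y\<close> back to \<open>x\<close>, so the iterates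
  of either are iterates of the other.\<close>

lemma cycle_eq:
  assumes "bij f" "y \<in> cycle f x"
  shows "cycle f y = cycle f x"
proof -
  obtain k where k: "y = perm_power f k x" using assms(2) unfolding cycle_def by blast
  have x: "x = perm_power f (- k) y"
    by (simp add: k flip: perm_power_add[OF assms(1)])
  have "perm_power f l y \<in> cycle f x" for l
    by (simp add: k flip: perm_power_add[OF assms(1)])
  moreover have "perm_power f l x \<in> cycle f y" for l
    by (subst x) (simp flip: perm_power_add[OF assms(1)])
  ultimately show ?thesis unfolding cycle_def by blast
qed

lemma apply_in_cycle: "bij f \<Longrightarrow> f x \<in> cycle f x"
  using perm_power_step[of f 0 x] perm_power_in_cycle[of f 1 x] by simp

lemma inv_apply_in_cycle: "bij f \<Longrightarrow> inv f x \<in> cycle f x"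
  using perm_power_in_cycle[of f "- 1" x] by (simp add: perm_power_def)

lemma Part_eq_imp_cycle_eq:
  assumes "bij f" "bij g" "Part f = Part g"
  shows "cycle f x = cycle g x"
proof -
  obtain z where "cycle f x = cycle g z"
    using assms(3) unfolding Part_def by blast
  then show ?thesis using cycle_eq[OF assms(2), of x z] self_in_cycle[of x f] by simp
qed

text \<open>Reducing exponents modulo \<open>d\<close> leaves only the iterates with exponents below
  \<open>d\<close>.\<close>

lemma cycle_length_le_period:
  assumes f: "bij f" and period: "(f ^^ d) x = x" and "d > 0"
  shows "cycle_length (cycle f x) \<le> enat d"
proof -
  have d: "perm_power f (int d) x = x" using period by (simp add: perm_power_of_nat)
  have *: "perm_power f (q * int d) x = x" for q
  proof (induction q rule: int_induct[where k = 0])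
    case (step1 i)
    then show ?case using perm_power_add[OF f, of "i * int d" "int d" x] d
      by (simp add: algebra_simps)
  next
    case (step2 i)
    then show ?case using perm_power_add[OF f, of "(i - 1) * int d" "int d" x] d
      by (simp add: algebra_simps)
  qed simp
  have "cycle f x \<subseteq> (\<lambda>i. (f ^^ i) x) ` {..<d}"
  proof
    fix y assume "y \<in> cycle f x"
    then obtain k where k: "y = perm_power f k x" unfolding cycle_def by blast
    have "perm_power f k x = perm_power f (k mod int d + (k div int d) * int d) x" by simp
    also have "\<dots> = perm_power f (k mod int d) x"
      by (simp only: perm_power_add[OF f, of "k mod int d"] *)
    also have "\<dots> = (f ^^ nat (k mod int d)) x"
      using \<open>d > 0\<close> perm_power_of_nat[of f "nat (k mod int d)" x] by simp
    finally show "y \<in> (\<lambda>i. (f ^^ i) x) ` {..<d}"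
      using \<open>d > 0\<close> k by (auto simp: nat_less_iff)
  qed
  then have "finite (cycle f x)" "card (cycle f x) \<le> d"
    using finite_surj surj_card_le by (blast, metis card_lessThan finite_lessThan)
  then show ?thesis by (simp add: cycle_length_def)
qed

text \<open>Replaces a comparison with a possibly infinite length by a bounded test on iterates of
  \<open>f\<close>, which is computable. Without a return to \<open>x\<close> within
  \<open>k\<close> steps, the first \<open>k + 1\<close> iterates are distinct.\<close>

lemma less_cycle_length_iff:
  assumes f: "bij f"
  shows "enat k < cycle_length (cycle f x) \<longleftrightarrow> (\<forall>i<k. (f ^^ Suc i) x \<noteq> x)"
proof
  assume less: "enat k < cycle_length (cycle f x)"
  show "\<forall>i<k. (f ^^ Suc i) x \<noteq> x"
  proof (intro allI impI notI)
    fix i assume "i < k" "(f ^^ Suc i) x = x"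
    then have "cycle_length (cycle f x) \<le> enat (Suc i)"
      using cycle_length_le_period[OF f, of "Suc i" x] by blast
    with less have "enat k < enat (Suc i)" by (rule less_le_trans)
    with \<open>i < k\<close> show False by simp
  qed
next
  assume *: "\<forall>i<k. (f ^^ Suc i) x \<noteq> x"
  have inj: "inj_on (\<lambda>i. (f ^^ i) x) {..k}"
  proof (rule linorder_inj_onI')
    fix i j assume "i \<in> {..k}" "j \<in> {..k}" "i < j"
    moreover from this obtain e where e: "j = i + Suc e"
      using less_iff_Suc_add by (metis add_Suc_right)
    ultimately have "(f ^^ Suc e) x \<noteq> x" using * by auto
    then show "(f ^^ i) x \<noteq> (f ^^ j) x"
      unfolding e funpow_add comp_apply using bij_fn[OF f, of i] by (metis bij_is_inj injD)
  qed
  show "enat k < cycle_length (cycle f x)"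
  proof (cases "finite (cycle f x)")
    case True
    have "(\<lambda>i. (f ^^ i) x) ` {..k} \<subseteq> cycle f x"
      using perm_power_in_cycle[of f _ x] by (auto simp flip: perm_power_of_nat)
    then have "Suc k \<le> card (cycle f x)"
      using card_inj_on_le[OF inj _ True] by simp
    with True show ?thesis by (simp add: cycle_length_def)
  qed (simp add: cycle_length_def)
qed

section \<open>The enumeration of a cycle along \<open>\<delta>\<close>\<close>

text \<open>The iterates with exponents 0, -1, 1, -2, 2, and so on, as in
  \<open>cycle_in_normal_form\<close>, but from an arbitrary starting point.\<close>

definition zigzag :: "('a \<Rightarrow> 'a) \<Rightarrow> 'a \<Rightarrow> nat \<Rightarrow> 'a" where
  "zigzag f a j = perm_power f (inv delta j) a"

lemma inv_delta: "inv delta j = (if even j then int (j div 2) else - int (j div 2) - 1)"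
  using bij_delta by (intro inv_f_eq) (auto simp: bij_is_inj delta_def elim!: oddE)

lemma zigzag_0 [simp]: "zigzag f a 0 = a"
  by (simp add: zigzag_def inv_delta)

lemma zigzag_in_cycle [simp]: "zigzag f a j \<in> cycle f a"
  by (simp add: zigzag_def)

lemma cycle_eq_range_zigzag: "cycle f a = range (zigzag f a)"
proof -
  have "perm_power f k a = zigzag f a (delta k)" for k
    using bij_delta by (simp add: zigzag_def bij_is_inj)
  then show ?thesis unfolding cycle_def by (auto simp: zigzag_def)
qed

text \<open>Truncated subtraction: the element at index 1 is mapped to the one at index 0.\<close>

lemma apply_zigzag_odd: "bij f \<Longrightarrow> odd j \<Longrightarrow> f (zigzag f a j) = zigzag f a (j - 2)"
  unfolding zigzag_def perm_power_step inv_delta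
  by (cases "j = 1") (auto elim!: oddE intro!: arg_cong[of _ _ "\<lambda>k. perm_power f k a"])

lemma apply_zigzag_even: "bij f \<Longrightarrow> even j \<Longrightarrow> f (zigzag f a j) = zigzag f a (j + 2)"
  unfolding zigzag_def perm_power_step inv_delta by (simp add: add.commute)

text \<open>A negative power is moved to the other side, so that the test needs forward iterates of
  \<open>f\<close> only.\<close>

lemma zigzag_eq_iff:
  assumes "bij f"
  shows "zigzag f a j = x \<longleftrightarrow>
    (if odd j then (f ^^ Suc (j div 2)) x = a else (f ^^ (j div 2)) a = x)"
proof (cases "odd j")
  case True
  define k where "k = int (Suc (j div 2))"
  have "inv delta j = - k" using True by (simp add: inv_delta k_def)
  then have "zigzag f a j = perm_power f (- k) a" by (simp add: zigzag_def)
  moreover have "perm_power f (- k) a = x \<longleftrightarrow> perm_power f k x = a"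
    using perm_power_add[OF assms, of k "- k" a] perm_power_add[OF assms, of "- k" k x] by auto
  moreover have "perm_power f k x = (f ^^ Suc (j div 2)) x"
    unfolding k_def by (rule perm_power_of_nat)
  ultimately show ?thesis using True by simp
qed (simp add: zigzag_def inv_delta perm_power_of_nat)

text \<open>The exponents at indices \<open>i < j\<close> differ by at most \<open>j\<close>, so a
  coincidence would give a period smaller than the length. Surjectivity follows by counting if the
  cycle is finite and from that of \<open>\<delta>\<close> otherwise.\<close>

lemma bij_betw_zigzag:
  assumes f: "bij f"
  shows "bij_betw (zigzag f a) {j. enat j < cycle_length (cycle f a)} (cycle f a)"
proof -
  let ?C = "cycle f a" and ?J = "{j. enat j < cycle_length (cycle f a)}"
  have inj: "inj_on (zigzag f a) ?J"
  proof (rule linorder_inj_onI')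
    fix i j assume ij: "i \<in> ?J" "j \<in> ?J" "i < j"
    define k where "k = inv delta j - inv delta i"
    define d where "d = nat \<bar>k\<bar>"
    have "k \<noteq> 0" "d \<le> j"
      using ij(3) unfolding d_def k_def inv_delta by (auto elim!: oddE evenE)
    show "zigzag f a i \<noteq> zigzag f a j"
    proof
      assume eq: "zigzag f a i = zigzag f a j"
      have "k = - inv delta i + inv delta j" by (simp add: k_def)
      then have "perm_power f k a = perm_power f (- inv delta i) (zigzag f a j)"
        by (simp only: zigzag_def perm_power_add[OF f])
      also have "\<dots> = perm_power f (- inv delta i) (zigzag f a i)" by (simp only: eq)
      also have "\<dots> = a" by (simp add: zigzag_def flip: perm_power_add[OF f])
      finally have k: "perm_power f k a = a" .
      then have "perm_power f (- k) a = a"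
        by (metis add.left_inverse perm_power_0 perm_power_add[OF f])
      with k have "(f ^^ d) a = a"
        by (cases "k \<ge> 0") (auto simp: d_def simp flip: perm_power_of_nat)
      then have "cycle_length ?C \<le> enat d"
        using cycle_length_le_period[OF f] \<open>k \<noteq> 0\<close> by (simp add: d_def)
      with \<open>d \<le> j\<close> ij(2) show False
        by (metis enat_ord_simps(1) leD mem_Collect_eq order_trans)
    qed
  qed
  moreover have "zigzag f a ` ?J = ?C"
  proof (cases "finite ?C")
    case True
    then have "?J = {..<card ?C}" by (auto simp: cycle_length_def)
    then have "card (zigzag f a ` ?J) = card ?C"
      using card_image[OF inj] by simp
    with True show ?thesis by (intro card_subset_eq) auto
  next
    case False
    then show ?thesis by (simp add: cycle_length_def cycle_eq_range_zigzag)
  qed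
  ultimately show ?thesis by (simp add: bij_betw_def)
qed

text \<open>The permutation of the indices that corresponds to one step along a cycle of length \<open>n\<close>:
  down the odd indices to \<open>0\<close>, then up the even ones, and from the last even index to the last odd
  one.\<close>

definition index_step :: "enat \<Rightarrow> nat \<Rightarrow> nat" where
  "index_step n j =
    (if odd j then j - 2
     else if enat (Suc (Suc j)) < n then j + 2
     else if enat (Suc j) < n then j + 1
     else j - 1)"

text \<open>The reverse walk, from 0 up the odd indices and back down the even ones; it witnesses
  that \<open>index_step\<close> permutes the indices below \<open>n\<close>.\<close>

definition index_step_inv :: "enat \<Rightarrow> nat \<Rightarrow> nat" where
  "index_step_inv n j =
    (if j = 0 then of_bool (1 < n)
     else if even j then j - 2
     else if enat (Suc (Suc j)) < n then j + 2
     else if enat (Suc j) < n then j + 1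
     else j - 1)"

lemma nat_cases_Suc_Suc:
  obtains "j = 0" | "j = 1" | k where "j = Suc (Suc k)"
  by (metis One_nat_def old.nat.exhaust)

lemma index_step_less: "enat j < n \<Longrightarrow> enat (index_step n j) < n"
  by (cases n) (auto simp: index_step_def)

lemma index_step_inv_less: "enat j < n \<Longrightarrow> enat (index_step_inv n j) < n"
  by (cases n) (auto simp: index_step_inv_def one_enat_def)

lemma index_step_inv_index_step: "enat j < n \<Longrightarrow> index_step_inv n (index_step n j) = j"
  unfolding index_step_def index_step_inv_def one_enat_def
  by (cases j rule: nat_cases_Suc_Suc; cases n) (simp_all add: odd_pos)

lemma index_step_index_step_inv: "enat j < n \<Longrightarrow> index_step n (index_step_inv n j) = j"
  unfolding index_step_def index_step_inv_def one_enat_def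
  by (cases j rule: nat_cases_Suc_Suc; cases n) simp_all

lemma apply_zigzag:
  assumes f: "bij f" and n: "n = cycle_length (cycle f a)" and j: "enat j < n"
  shows "f (zigzag f a j) = zigzag f a (index_step n j)"
proof (cases "odd j \<or> enat (Suc (Suc j)) < n")
  case True
  then show ?thesis
    using apply_zigzag_odd[OF f] apply_zigzag_even[OF f] by (auto simp: index_step_def)
next
  case False
  then have last: "even j" "\<not> enat (j + 2) < n" by auto
  \<comment> \<open>Every other index is already known to be the image of an index different from \<open>j\<close>.\<close>
  have inj: "i = j" if "zigzag f a i = zigzag f a j" "enat i < n" for i
    using bij_betw_zigzag[OF f, of a] that j n by (auto simp: bij_betw_def inj_on_def)
  have "f (zigzag f a j) \<in> cycle f a"
    using apply_in_cycle[OF f] cycle_eq[OF f zigzag_in_cycle] by metis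
  then obtain i where i: "f (zigzag f a j) = zigzag f a i" "enat i < n"
    using bij_betw_zigzag[OF f, of a] n by (auto simp: bij_betw_def image_iff)
  have *: "k = j" if "f (zigzag f a k) = zigzag f a i" "enat k < n" for k
    using inj[OF _ that(2)] that(1) i(1) f by (metis bij_is_inj injD)
  have "i = index_step n j"
  \<comment> \<open>A positive even \<open>i\<close> is the image of \<open>i - 2\<close>, which
    would then be \<open>j\<close>, although \<open>j + 2\<close> is out of range.\<close>
  proof (cases "even i")
    case True
    have "i = 0"
    proof (rule ccontr)
      assume "i \<noteq> 0"
      with True have b: "i = i - 2 + 2" "even (i - 2)" by presburger+
      have "enat (i - 2) < n" using i(2) le_less_trans[of "enat (i - 2)" "enat i"] by simp
      then have "i - 2 = j"
        using apply_zigzag_even[OF f b(2), of a] b(1) by (intro *) simp_all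
      with b(1) i(2) last(2) show False by simp
    qed
    \<comment> \<open>Index 1 is sent to 0, so if present it would equal the even index
      \<open>j\<close>; hence the cycle has length 1.\<close>
    have "\<not> enat 1 < n"
      using *[of 1] apply_zigzag_odd[OF f, of 1 a] last(1) \<open>i = 0\<close> by auto
    then have "n \<le> enat 1" by simp
    then have "j = 0" using j by (metis enat_ord_simps(2) less_le_trans less_one)
    with \<open>i = 0\<close> \<open>\<not> enat 1 < n\<close> last show ?thesis
      by (auto simp: index_step_def numeral_2_eq_2)
  next
    case False
    \<comment> \<open>Otherwise the odd index \<open>i + 2\<close> would also be sent to
      \<open>i\<close>. Thus \<open>i\<close> is the last odd index.\<close>
    then have "\<not> enat (i + 2) < n"
      using *[of "i + 2"] apply_zigzag_odd[OF f, of "i + 2" a] last(1) by auto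
    moreover from this obtain m where m: "n = enat m" by (cases n) auto
    ultimately have "i < m" "\<not> i + 2 < m" "j < m" "\<not> j + 2 < m"
      using last j i(2) by simp_all
    with False last(1) have "i = (if Suc j < m then j + 1 else j - 1)" by presburger
    with last m show ?thesis by (simp add: index_step_def)
  qed
  with i show ?thesis by simp
qed

section \<open>The normal form\<close>

definition rank :: "nat set \<Rightarrow> nat \<Rightarrow> nat" where
  "rank C x = card {y \<in> C. y < x}"

lemma rank_less:
  assumes "x \<in> C" "x < y"
  shows "rank C x < rank C y"
  unfolding rank_def using assms by (intro psubset_card_mono) auto

text \<open>Ranks have no gaps: if \<open>x\<close> has rank \<open>j\<close> and the set has more
  than \<open>j + 1\<close> elements, then the least element above \<open>x\<close> has rank
  \<open>j + 1\<close>.\<close>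

lemma bij_betw_rank: "bij_betw (rank C) C {j. enat j < cycle_length C}"
  unfolding bij_betw_def
proof (intro conjI antisym subsetI)
  show "inj_on (rank C) C"
    by (rule linorder_inj_onI') (auto dest: rank_less)
next
  fix j assume "j \<in> rank C ` C"
  then obtain x where x: "x \<in> C" "j = rank C x" by blast
  have "rank C x < card C" if "finite C"
    unfolding rank_def using that x by (intro psubset_card_mono) auto
  with x show "j \<in> {j. enat j < cycle_length C}"
    by (simp add: cycle_length_def)
next
  have "\<exists>x\<in>C. rank C x = j" if "enat j < cycle_length C" for j
    using that
  proof (induction j)
    case 0
    then have "C \<noteq> {}" by (auto simp: cycle_length_def zero_enat_def)
    then have "(LEAST x. x \<in> C) \<in> C" by (auto intro: LeastI)
    then show ?case by (intro bexI[of _ "LEAST x. x \<in> C"]) (auto simp: rank_def dest: not_less_Least)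
  next
    case (Suc j)
    then have "enat j < cycle_length C" by (metis enat_ord_simps(2) lessI less_trans)
    then obtain x where x: "x \<in> C" "rank C x = j" using Suc.IH by blast
    have lower: "{y \<in> C. y \<le> x} = insert x {y \<in> C. y < x}" using x by auto
    then have card: "card {y \<in> C. y \<le> x} = Suc j"
      using x by (simp add: rank_def)
    have "\<exists>y. y \<in> C \<and> x < y"
    proof (rule ccontr)
      assume "\<nexists>y. y \<in> C \<and> x < y"
      then have C: "C = {y \<in> C. y \<le> x}" by auto
      then have "finite C" by (metis finite_Collect_conjI finite_Collect_le_nat)
      with Suc.prems card C show False by (simp add: cycle_length_def)
    qed
    then obtain y where y: "y \<in> C" "x < y" "\<And>z. z \<in> C \<Longrightarrow> x < z \<Longrightarrow> y \<le> z"
      using exists_least_iff[of "\<lambda>y. y \<in> C \<and> x < y"] by (metis not_le)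
    then have "{z \<in> C. z < y} = {z \<in> C. z \<le> x}" 
      by (intro Collect_cong) (metis not_le le_less_trans)
    with card y show ?case by (intro bexI[of _ y]) (simp_all add: rank_def)
  qed
  then show "j \<in> rank C ` C" if "j \<in> {j. enat j < cycle_length C}" for j
    using that by blast
qed

text \<open>The inverse of \<open>rank\<close> on \<open>C\<close>, written as a search so that it
  is computable from membership and ranks.\<close>

definition element :: "nat set \<Rightarrow> nat \<Rightarrow> nat" where
  "element C j = (LEAST x. x \<in> C \<and> rank C x = j)"

lemma ex_rank_eq: "enat j < cycle_length C \<Longrightarrow> \<exists>x. x \<in> C \<and> rank C x = j"
  using bij_betw_rank[of C] by (auto simp: bij_betw_def image_iff set_eq_iff) metis

lemma
  assumes "enat j < cycle_length C"
  shows element_in: "element C j \<in> C" and rank_element: "rank C (element C j) = j"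
  using LeastI_ex[OF ex_rank_eq[OF assms]] unfolding element_def by auto

lemma rank_less_cycle_length: "x \<in> C \<Longrightarrow> enat (rank C x) < cycle_length C"
  using bij_betw_rank[of C] by (auto simp: bij_betw_def)

lemma element_rank: "x \<in> C \<Longrightarrow> element C (rank C x) = x"
  using bij_betw_rank[of C] element_in[OF rank_less_cycle_length] rank_element[OF rank_less_cycle_length]
  by (auto simp: bij_betw_def inj_on_def)

lemma element_0:
  assumes "x \<in> C"
  shows "element C 0 = (LEAST a. a \<in> C)"
proof -
  have "{y \<in> C. y < (LEAST a. a \<in> C)} = {}" by (auto dest: not_less_Least)
  then have "rank C (LEAST a. a \<in> C) = 0" unfolding rank_def by simp
  then show ?thesis
    using element_rank[of "LEAST a. a \<in> C" C] LeastI[of "\<lambda>a. a \<in> C" x] assms by simp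
qed

lemma element_strict_mono:
  assumes "enat j < cycle_length C" "i < j"
  shows "element C i < element C j"
proof (rule ccontr)
  have i: "enat i < cycle_length C"
    using assms le_less_trans[of "enat i" "enat j"] by simp
  assume "\<not> element C i < element C j"
  then have "rank C (element C j) \<le> rank C (element C i)"
    unfolding rank_def by (intro card_mono) auto
  with assms i show False by (simp add: rank_element)
qed

text \<open>An explicit candidate for the normal form: one step along the cycle, carried over from
  indices to ranks. The definite description in \<open>normal_form\<close> gives no access to
  computability.\<close>

definition canonical :: "(nat \<Rightarrow> nat) \<Rightarrow> nat \<Rightarrow> nat" where
  "canonical f x =
    (let C = cycle f x in element C (index_step (cycle_length C) (rank C x)))"

lemma canonical_element:
  assumes "bij f" "C = cycle f x" "enat j < cycle_length C"
  shows "canonical f (element C j) = element C (index_step (cycle_length C) j)"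
  using cycle_eq[OF assms(1), of "element C j" x] assms element_in[of j C] rank_element[of j C]
  by (simp add: canonical_def Let_def)

lemma cycle_elementE:
  assumes "x \<in> C"
  obtains j where "enat j < cycle_length C" "x = element C j"
  using rank_less_cycle_length[OF assms] element_rank[OF assms] by metis

lemma bij_canonical:
  assumes f: "bij f"
  shows "bij (canonical f)"
proof -
  \<comment> \<open>The inverse walks backwards on the ranks of the same cycle.\<close>
  define g where "g x = element (cycle f x)
    (index_step_inv (cycle_length (cycle f x)) (rank (cycle f x) x))" for x
  have g: "g (element C j) = element C (index_step_inv (cycle_length C) j)"
    if "C = cycle f x" "enat j < cycle_length C" for C x j
    using cycle_eq[OF f, of "element C j" x] that element_in[of j C] rank_element[of j C]
    by (simp add: g_def)
  have "canonical f (g x) = x \<and> g (canonical f x) = x" for x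
  proof -
    obtain j where j: "enat j < cycle_length (cycle f x)" "x = element (cycle f x) j"
      by (rule cycle_elementE[OF self_in_cycle])
    define C where "C = cycle f x"
    have C: "enat j < cycle_length C" "x = element C j" using j by (simp_all add: C_def)
    show ?thesis
      unfolding C(2) using C(1)
      by (simp add: canonical_element[OF f C_def] g[OF C_def] index_step_less index_step_inv_less
          index_step_inv_index_step index_step_index_step_inv)
  qed
  then show ?thesis by (intro bij_betw_byWitness[of _ g]) auto
qed

lemma cycle_canonical_subset:
  assumes f: "bij f"
  shows "cycle (canonical f) x \<subseteq> cycle f x"
proof -
  have step: "canonical f y \<in> cycle f y" for y
    using index_step_less[OF rank_less_cycle_length[OF self_in_cycle]]
    by (auto simp: canonical_def Let_def intro: element_in)
  have "perm_power (canonical f) k x \<in> cycle f x" for k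
  proof (induction k rule: int_induct[where k = 0])
    case (step1 i)
    have "canonical f (perm_power (canonical f) i x) \<in> cycle f x"
      using step[of "perm_power (canonical f) i x"] cycle_eq[OF f step1(2)] by simp
    then show ?case
      by (simp only: perm_power_step[OF bij_canonical[OF f]])
  next
    case (step2 i)
    let ?y = "perm_power (canonical f) (i - 1) x"
    have "canonical f ?y = perm_power (canonical f) i x"
      by (simp add: perm_power_step[OF bij_canonical[OF f]])
    \<comment> \<open>Going backwards, the cycle of \<open>?y\<close> contains its image, which is
      already known to lie in the cycle of \<open>x\<close>.\<close>
    then have "cycle f (perm_power (canonical f) i x) = cycle f ?y"
      using cycle_eq[OF f step[of ?y]] by simp
    then show ?case
      using cycle_eq[OF f step2(2)] self_in_cycle[of ?y f] by simp
  qed simp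
  then show ?thesis unfolding cycle_def by blast
qed

text \<open>Strong induction on \<open>j\<close>. An even index is reached by one step from
  \<open>j - 2\<close>; for an odd one both sides have the same image, at index \<open>j - 2\<close>
  (0 if \<open>j = 1\<close>), and injectivity applies.\<close>

lemma zigzag_canonical:
  assumes f: "bij f" and C: "C = cycle f x" and j: "enat j < cycle_length C"
  shows "zigzag (canonical f) (element C 0) j = element C j"
  using j
proof (induction j rule: less_induct)
  case (less j)
  let ?g = "canonical f"
  note g = bij_canonical[OF f] and elem = canonical_element[OF f C]
  have IH: "zigzag ?g (element C 0) i = element C i" if "i < j" for i
    using less that le_less_trans[of "enat i" "enat j"] by simp
  consider "j = 0" | "odd j" | "even j" "j \<noteq> 0" by blast
  then show ?case
  proof cases
    case 2
    then have "j - 2 < j" by (cases j) auto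
    have "?g (zigzag ?g (element C 0) j) = zigzag ?g (element C 0) (j - 2)"
      by (rule apply_zigzag_odd[OF g 2])
    also have "\<dots> = element C (j - 2)" by (rule IH[OF \<open>j - 2 < j\<close>])
    also have "\<dots> = ?g (element C j)" using 2 elem[OF less.prems] by (simp add: index_step_def)
    finally show ?thesis using g by (meson bij_is_inj injD)
  next
    case 3
    define k where "k = j - 2"
    have k: "even k" "j = k + 2" using 3 unfolding k_def by presburger+
    have "zigzag ?g (element C 0) j = ?g (zigzag ?g (element C 0) k)"
      unfolding k(2) by (rule apply_zigzag_even[OF g k(1), symmetric])
    also have "\<dots> = ?g (element C k)" using IH[of k] k(2) by simp
    also have "\<dots> = element C (index_step (cycle_length C) k)"
      using less.prems k(2) le_less_trans[of "enat k" "enat j"] by (intro elem) simp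
    also have "\<dots> = element C j" using less.prems k by (simp add: index_step_def)
    finally show ?thesis .
  qed simp
qed

text \<open>The reverse inclusion holds because the zigzag from the least element reaches every
  rank.\<close>

lemma cycle_canonical:
  assumes f: "bij f"
  shows "cycle (canonical f) x = cycle f x"
proof -
  define C where "C = cycle f x"
  define a where "a = element C 0"
  have "C \<subseteq> cycle (canonical f) a"
  proof
    fix y assume "y \<in> C"
    then obtain j where "enat j < cycle_length C" "y = element C j"
      by (rule cycle_elementE)
    then show "y \<in> cycle (canonical f) a"
      using zigzag_canonical[OF f C_def] zigzag_in_cycle a_def by metis
  qed
  moreover have "x \<in> C" by (simp add: C_def)
  ultimately have "cycle (canonical f) a = cycle (canonical f) x"
    using cycle_eq[OF bij_canonical[OF f]] by blast
  then show ?thesis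
    using \<open>C \<subseteq> _\<close> cycle_canonical_subset[OF f] C_def by blast
qed

lemma normal_canonical:
  assumes f: "bij f"
  shows "normal (canonical f)"
  unfolding normal_def
proof (intro conjI ballI)
  show "bij (canonical f)" by (rule bij_canonical[OF f])
  fix C assume "C \<in> Part (canonical f)"
  then obtain x where C: "C = cycle f x" unfolding Part_def by (auto simp: cycle_canonical[OF f])
  have a: "(LEAST a. a \<in> C) = element C 0" using element_0[of x C] C by simp
  show "cycle_in_normal_form (canonical f) C"
    unfolding cycle_in_normal_form_def a zigzag_def[symmetric]
  proof (rule strict_mono_onI)
    fix i j assume ij: "i \<in> {j. enat j < cycle_length C}" "j \<in> {j. enat j < cycle_length C}" "i < j"
    then show "zigzag (canonical f) (element C 0) i < zigzag (canonical f) (element C 0) j"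
      by (simp add: zigzag_canonical[OF f C] element_strict_mono)
  qed
qed

text \<open>An increasing enumeration of a set is unique: exactly the entries with smaller index lie
  below entry \<open>j\<close>, which therefore has rank \<open>j\<close>.\<close>

lemma zigzag_normal:
  assumes g: "normal g" and C: "C = cycle g x" and j: "enat j < cycle_length C"
  shows "zigzag g (element C 0) j = element C j"
proof -
  let ?z = "zigzag g (element C 0)" and ?J = "{j. enat j < cycle_length C}"
  have "bij g" using g by (simp add: normal_def)
  have mono: "strict_mono_on ?J ?z"
    using g C element_0[of x C] unfolding normal_def cycle_in_normal_form_def Part_def zigzag_def by simp
  have "element C 0 \<in> cycle g x"
    using element_in[of 0 C] j C le_less_trans[of "enat 0" "enat j"] by simp
  from cycle_eq[OF \<open>bij g\<close> this] have bij: "bij_betw ?z ?J C"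
    using bij_betw_zigzag[OF \<open>bij g\<close>, of "element C 0"] C by simp
  have J: "i \<in> ?J" if "i < j" for i
    using that j le_less_trans[of "enat i" "enat j"] by simp
  have "{y \<in> C. y < ?z j} = ?z ` {..<j}"
  proof (intro antisym subsetI)
    fix y assume "y \<in> {y \<in> C. y < ?z j}"
    then obtain i where i: "i \<in> ?J" "y = ?z i" "?z i < ?z j"
      using bij by (auto simp: bij_betw_def)
    then have "i < j"
      using strict_mono_on_less[OF mono, of i j] j by simp
    with i show "y \<in> ?z ` {..<j}" by blast
  next
    fix y assume "y \<in> ?z ` {..<j}"
    then obtain i where i: "i < j" "y = ?z i" by blast
    then show "y \<in> {y \<in> C. y < ?z j}"
      using bij strict_mono_onD[OF mono J[OF i(1)] _ i(1)] j J[OF i(1)] by (auto simp: bij_betw_def)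
  qed
  moreover have "inj_on ?z {..<j}"
    using bij J by (auto simp: bij_betw_def intro: inj_on_subset)
  ultimately have "rank C (?z j) = j"
    by (simp add: rank_def card_image)
  moreover have "?z j \<in> C" using bij j by (auto simp: bij_betw_def)
  ultimately show ?thesis using element_rank by metis
qed

text \<open>Both maps enumerate each cycle in increasing order, and \<open>apply_zigzag\<close>
  determines how \<open>g\<close> acts on the indices.\<close>

lemma normal_eq_canonical:
  assumes f: "bij f" and g: "normal g" and Part: "Part g = Part f"
  shows "g = canonical f"
proof
  fix x
  define C where "C = cycle g x"
  have "bij g" using g by (simp add: normal_def)
  have C: "C = cycle f x"
    using Part_eq_imp_cycle_eq[OF \<open>bij g\<close> f Part] by (simp add: C_def)
  have "x \<in> C" by (simp add: C_def)
  then obtain j where j: "enat j < cycle_length C" "x = element C j" by (rule cycle_elementE)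
  have "element C 0 \<in> cycle g x"
    using element_in[of 0 C] j(1) C_def le_less_trans[of "enat 0" "enat j"] by simp
  then have a: "cycle g (element C 0) = C"
    using cycle_eq[OF \<open>bij g\<close>] C_def by simp
  have "g x = g (zigzag g (element C 0) j)"
    using zigzag_normal[OF g C_def j(1)] j(2) by simp
  also have "\<dots> = zigzag g (element C 0) (index_step (cycle_length C) j)"
    using apply_zigzag[OF \<open>bij g\<close>, of _ "element C 0" j] a j(1) by simp
  also have "\<dots> = element C (index_step (cycle_length C) j)"
    using zigzag_normal[OF g C_def] index_step_less[OF j(1)] by simp
  also have "\<dots> = canonical f x"
    using canonical_element[OF f C j(1)] j(2) by simp
  finally show "g x = canonical f x" .
qed

lemma normal_form_eq_canonical:
  assumes "bij f"
  shows "normal_form f = canonical f"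
  unfolding normal_form_def
proof (rule the_equality)
  show "normal (canonical f) \<and> Part (canonical f) = Part f"
    using normal_canonical[OF assms] cycle_canonical[OF assms] by (simp add: Part_def)
qed (use normal_eq_canonical[OF assms] in blast)

section \<open>The conjugation\<close>

text \<open>On a finite cycle several indices name the same element; the least of them is the one
  below the length.\<close>

definition zigzag_index :: "(nat \<Rightarrow> nat) \<Rightarrow> nat \<Rightarrow> nat" where
  "zigzag_index f x = (LEAST j. zigzag f (LEAST a. a \<in> cycle f x) j = x)"

definition conjugator :: "(nat \<Rightarrow> nat) \<Rightarrow> nat \<Rightarrow> nat" where
  "conjugator f x = element (cycle f x) (zigzag_index f x)"

context
  fixes f :: "nat \<Rightarrow> nat" and x :: nat and C :: "nat set" and a :: nat
  assumes f: "bij f" and C: "C = cycle f x" and a: "a = (LEAST a. a \<in> C)"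
begin

lemma cycle_least: "cycle f a = C"
  using cycle_eq[OF f, of a x] LeastI[of "\<lambda>a. a \<in> C" x] C a by simp

lemma cycle_zigzagE:
  assumes "y \<in> C"
  obtains j where "enat j < cycle_length C" "y = zigzag f a j"
  using bij_betw_zigzag[OF f, of a] assms unfolding cycle_least by (auto simp: bij_betw_def)

lemma zigzag_index_zigzag:
  assumes "enat j < cycle_length C"
  shows "zigzag_index f (zigzag f a j) = j"
proof -
  let ?i = "LEAST i. zigzag f a i = zigzag f a j"
  have "cycle f (zigzag f a j) = C"
    using cycle_eq[OF f zigzag_in_cycle] cycle_least by metis
  then have "zigzag_index f (zigzag f a j) = ?i"
    using a by (simp add: zigzag_index_def)
  moreover have "zigzag f a ?i = zigzag f a j" by (rule LeastI) simp
  moreover have "?i \<le> j" by (rule Least_le) simp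
  moreover from this assms have "enat ?i < cycle_length C"
    using le_less_trans[of "enat ?i" "enat j"] by simp
  ultimately show ?thesis
    using bij_betw_zigzag[OF f, of a] assms unfolding cycle_least by (auto simp: bij_betw_def inj_on_def)
qed

lemma conjugator_zigzag:
  assumes "enat j < cycle_length C"
  shows "conjugator f (zigzag f a j) = element C j"
  using zigzag_index_zigzag[OF assms] cycle_eq[OF f zigzag_in_cycle, of a j] cycle_least
  by (simp add: conjugator_def)

lemma zigzag_index_less: "enat (zigzag_index f x) < cycle_length C"
  using cycle_zigzagE[of x] zigzag_index_zigzag C by (metis self_in_cycle)

end

lemma bij_conjugator:
  assumes f: "bij f"
  shows "bij (conjugator f)"
proof -
  \<comment> \<open>The inverse reads the rank of \<open>x\<close> as an index of the
    zigzag.\<close>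
  define k where "k x = zigzag f (LEAST a. a \<in> cycle f x) (rank (cycle f x) x)" for x
  have "conjugator f (k x) = x \<and> k (conjugator f x) = x" for x
  proof -
    define C where "C = cycle f x"
    define a where "a = (LEAST a. a \<in> C)"
    note conj = conjugator_zigzag[OF f C_def a_def]
    have "x \<in> C" by (simp add: C_def)
    from cycle_zigzagE[OF f C_def a_def this] obtain j
      where j: "enat j < cycle_length C" "x = zigzag f a j" .
    have "cycle f (element C j) = C"
      using cycle_eq[OF f, of "element C j" x] element_in[OF j(1)] C_def by simp
    then have "k (element C j) = zigzag f a j"
      using rank_element[OF j(1)] by (simp add: k_def a_def)
    then have "k (conjugator f x) = x" using conj[OF j(1)] j(2) by simp
    moreover have "conjugator f (k x) = x"
      using conj[OF rank_less_cycle_length[OF \<open>x \<in> C\<close>]] element_rank[OF \<open>x \<in> C\<close>]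
      by (simp add: k_def a_def C_def)
    ultimately show ?thesis by simp
  qed
  then show ?thesis by (intro bij_betw_byWitness[of _ k]) auto
qed

text \<open>On indices and on ranks alike, one step is \<open>index_step\<close> for the same
  length.\<close>

lemma conjugator_apply:
  assumes f: "bij f"
  shows "conjugator f (f x) = canonical f (conjugator f x)"
proof -
  define C where "C = cycle f x"
  define a where "a = (LEAST a. a \<in> C)"
  note conj = conjugator_zigzag[OF f C_def a_def]
  have "x \<in> C" by (simp add: C_def)
  from cycle_zigzagE[OF f C_def a_def this] obtain j
    where j: "enat j < cycle_length C" "x = zigzag f a j" .
  have "f x = zigzag f a (index_step (cycle_length C) j)"
    using apply_zigzag[OF f _ j(1), of a] j cycle_least[OF f C_def a_def] by simp
  then show ?thesis
    using conj[OF j(1)] conj[OF index_step_less[OF j(1)]] canonical_element[OF f C_def j(1)] j(2)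
    by simp
qed

lemma conjugate_canonical:
  assumes "bij f"
  shows "f = inv (conjugator f) \<circ> canonical f \<circ> conjugator f"
  using bij_conjugator[OF assms] by (auto simp: bij_is_inj simp flip: conjugator_apply[OF assms])

section \<open>From a decider to the normal form\<close>

context
  fixes f :: "nat \<Rightarrow> nat" and q :: recf
  assumes f: "bij f" and q: "decides_Part q f"
begin

lemma urec_in_cycle:
  assumes "urec {f} n A" "urec {f} n B"
  shows "urec {f} n (\<lambda>\<phi> xs. of_bool (B \<phi> xs \<in> cycle f (A \<phi> xs)))"
  by (rule urec_binary[where b="\<lambda>_ x y. of_bool (y \<in> cycle f x)", OF _ assms], rule urec_program[of _ q])
     (use q in \<open>auto simp: decides_Part_def numeral_2_eq_2 length_Suc_conv\<close>)

lemma urec_rank: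
  assumes "urec {f} n A" "urec {f} n B"
  shows "urec {f} n (\<lambda>\<phi> xs. rank (cycle f (A \<phi> xs)) (B \<phi> xs))"
proof (rule urec_binary[where b="\<lambda>_ x y. rank (cycle f x) y", OF _ assms])
  have "urec {f} 2 (\<lambda>\<phi> xs. rec_nat 0 (\<lambda>m v. v + of_bool (m \<in> cycle f (xs ! 0))) (xs ! 1))"
    by (intro urec_rec_nat urec_add urec_in_cycle urec_nth urec_nth_drop urec_const) auto
  moreover have "rec_nat 0 (\<lambda>m v. v + of_bool (m \<in> C)) k = rank C k" for C k
  proof (induction k)
    case (Suc k)
    have "{y \<in> C. y < Suc k} = (if k \<in> C then insert k {y \<in> C. y < k} else {y \<in> C. y < k})"
      by (auto simp: less_Suc_eq)
    with Suc show ?case by (simp add: rank_def)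
  qed (simp add: rank_def)
  ultimately show "urec {f} 2 (\<lambda>\<phi> xs. rank (cycle f (xs ! 0)) (xs ! 1))" by simp
qed

lemma urec_less_cycle_length:
  assumes "urec {f} n A" "urec {f} n K"
  shows "urec {f} n (\<lambda>\<phi> xs. of_bool (enat (K \<phi> xs) < cycle_length (cycle f (A \<phi> xs))))"
proof (rule urec_binary[where b="\<lambda>_ x k. of_bool (enat k < cycle_length (cycle f x))", OF _ assms])
  have "urec {f} 2 (\<lambda>\<phi> xs. of_bool (\<forall>i<xs ! 1. (\<phi> ^^ Suc i) (xs ! 0) \<noteq> xs ! 0))"
    by (intro urec_less_all urec_not urec_eq urec_funpow urec_Suc urec_oracle urec_nth urec_nth_drop) auto
  then show "urec {f} 2 (\<lambda>\<phi> xs. of_bool (enat (xs ! 1) < cycle_length (cycle f (xs ! 0))))"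
    by (rule urec_cong) (simp add: less_cycle_length_iff[OF f])
qed

lemma urec_index_step:
  assumes "urec {f} n A" "urec {f} n J"
  shows "urec {f} n (\<lambda>\<phi> xs. index_step (cycle_length (cycle f (A \<phi> xs))) (J \<phi> xs))"
  unfolding index_step_def
  by (intro urec_if urec_parity urec_less_cycle_length urec_add urec_diff urec_Suc urec_const assms)

text \<open>The bound on \<open>J\<close> guarantees that the search for an element of this rank
  ends.\<close>

lemma urec_element:
  assumes "urec {f} n A" "urec {f} n J"
    and less: "\<And>xs. length xs = n \<Longrightarrow> enat (J f xs) < cycle_length (cycle f (A f xs))"
  shows "urec {f} n (\<lambda>\<phi> xs. element (cycle f (A \<phi> xs)) (J \<phi> xs))"
  unfolding element_def
proof (rule urec_Least)
  have "urec {f} (Suc n) (\<lambda>\<phi> zs. A \<phi> (drop 1 zs))" "urec {f} (Suc n) (\<lambda>\<phi> zs. J \<phi> (drop 1 zs))"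
    by (rule urec_drop[OF assms(1)] urec_drop[OF assms(2)], simp)+
  then show "urec {f} (Suc n) (\<lambda>\<phi> zs. of_bool (zs ! 0 \<in> cycle f (A \<phi> (drop 1 zs)) \<and>
      rank (cycle f (A \<phi> (drop 1 zs))) (zs ! 0) = J \<phi> (drop 1 zs)))"
    by (intro urec_conj urec_in_cycle urec_eq urec_rank urec_nth) auto
qed (use ex_rank_eq less in auto)

lemma urec_canonical: "urec {f} 1 (\<lambda>_ xs. canonical f (xs ! 0))"
  unfolding canonical_def Let_def
  by (intro urec_element urec_index_step urec_rank urec_nth)
     (auto intro!: index_step_less rank_less_cycle_length)

lemma urec_least_of_cycle:
  assumes "urec {f} n A"
  shows "urec {f} n (\<lambda>\<phi> xs. LEAST a. a \<in> cycle f (A \<phi> xs))"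
proof (rule urec_Least)
  show "urec {f} (Suc n) (\<lambda>\<phi> zs. of_bool (zs ! 0 \<in> cycle f (A \<phi> (drop 1 zs))))"
    by (rule urec_in_cycle, rule urec_drop[OF assms], simp, rule urec_nth, simp)
qed (rule exI, rule self_in_cycle)

lemma urec_zigzag_index: "urec {f} 1 (\<lambda>_ xs. zigzag_index f (xs ! 0))"
  unfolding zigzag_index_def
proof (rule urec_Least)
  \<comment> \<open>With the parity test outermost, \<open>urec_if\<close> applies and both branches
    are equations between iterates.\<close>
  have *: "of_bool (zigzag f a j = y) =
    (if odd j then of_bool ((f ^^ Suc (j div 2)) y = a) else of_bool ((f ^^ (j div 2)) a = y) :: nat)"
    for a j y by (simp only: zigzag_eq_iff[OF f] if_split) simp
  have "urec {f} 2 (\<lambda>\<phi> zs. if odd (zs ! 0)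
     then of_bool ((\<phi> ^^ Suc (zs ! 0 div 2)) (zs ! 1) = (LEAST a. a \<in> cycle f (zs ! 1)))
     else of_bool ((\<phi> ^^ (zs ! 0 div 2)) (LEAST a. a \<in> cycle f (zs ! 1)) = zs ! 1))"
    by (intro urec_if urec_parity urec_eq urec_funpow urec_Suc urec_half urec_oracle
        urec_least_of_cycle urec_nth) auto
  then show "urec {f} (Suc 1) (\<lambda>_ zs. of_bool (zigzag f (LEAST a. a \<in> cycle f (drop 1 zs ! 0)) (zs ! 0)
      = drop 1 zs ! 0))"
    unfolding * Suc_1 by (rule urec_cong) auto
next
  fix xs :: "nat list"
  show "\<exists>j. zigzag f (LEAST a. a \<in> cycle f (xs ! 0)) j = xs ! 0"
    using cycle_zigzagE[OF f refl refl, of "xs ! 0" "xs ! 0"] by (metis self_in_cycle)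
qed

lemma urec_conjugator: "urec {f} 1 (\<lambda>_ xs. conjugator f (xs ! 0))"
  unfolding conjugator_def
  by (intro urec_element urec_zigzag_index urec_nth) (auto intro: zigzag_index_less[OF f])

end

section \<open>From the normal form to a decider\<close>

definition descent :: "(nat \<Rightarrow> nat) \<Rightarrow> nat \<Rightarrow> nat" where
  "descent g x = min x (min (g x) (inv g x))"

text \<open>For odd \<open>j\<close> the element of rank \<open>j\<close> is mapped to a smaller one, for even \<open>j > 0\<close> it is the
  image of a smaller one.\<close>

lemma descent_less:
  assumes g: "normal g" and x: "x \<noteq> (LEAST a. a \<in> cycle g x)"
  shows "descent g x < x"
proof -
  define C where "C = cycle g x"
  define a where "a = element C 0"
  have "bij g" using g by (simp add: normal_def)
  have "x \<in> C" by (simp add: C_def)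
  then obtain j where j: "enat j < cycle_length C" "x = element C j" by (rule cycle_elementE)
  have "j \<noteq> 0"
    using x j(2) unfolding C_def[symmetric] element_0[OF \<open>x \<in> C\<close>, symmetric] by metis
  have less: "enat i < cycle_length C" if "i < j" for i
    using j that le_less_trans[of "enat i" "enat j"] by simp
  have z: "zigzag g a i = element C i" if "i \<le> j" for i
    using zigzag_normal[OF g C_def] less j(1) that unfolding a_def by (metis le_eq_less_or_eq)
  have mono: "element C i < x" if "i < j" for i
    using element_strict_mono[OF j(1) that] j(2) by simp
  show ?thesis
  proof (cases "odd j")
    case True
    then have "g x = element C (j - 2)"
      using apply_zigzag_odd[OF \<open>bij g\<close>, of j a] j(2) by (simp add: z)
    then show ?thesis using mono[of "j - 2"] \<open>j \<noteq> 0\<close> by (simp add: descent_def)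
  next
    case False
    then have k: "even (j - 2)" "j - 2 + 2 = j" using \<open>j \<noteq> 0\<close> by presburger+
    have "g (element C (j - 2)) = x"
      using apply_zigzag_even[OF \<open>bij g\<close> k(1), of a] unfolding k(2) j(2) by (simp add: z)
    then have "inv g x = element C (j - 2)"
      using bij_is_inj[OF \<open>bij g\<close>] by (intro inv_f_eq)
    then show ?thesis using mono[of "j - 2"] \<open>j \<noteq> 0\<close> by (simp add: descent_def)
  qed
qed

lemma descent_in_cycle: "bij g \<Longrightarrow> descent g x \<in> cycle g x"
  using apply_in_cycle[of g x] inv_apply_in_cycle[of g x] by (auto simp: descent_def min_def)

text \<open>Every step lowers the value by at least 1 until the least element is reached, which is a
  fixed point.\<close>

lemma funpow_descent:
  assumes g: "normal g"
  shows "(descent g ^^ x) x = (LEAST a. a \<in> cycle g x)"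
proof -
  let ?a = "LEAST a. a \<in> cycle g x"
  have "bij g" using g by (simp add: normal_def)
  have cyc: "(descent g ^^ m) x \<in> cycle g x" for m
  proof (induction m)
    case (Suc m)
    then show ?case
      using descent_in_cycle[OF \<open>bij g\<close>, of "(descent g ^^ m) x"] cycle_eq[OF \<open>bij g\<close> Suc] by simp
  qed simp
  have "(descent g ^^ m) x = ?a \<or> (descent g ^^ m) x + m \<le> x" for m
  proof (induction m)
    case (Suc m)
    let ?y = "(descent g ^^ m) x"
    have eq: "cycle g ?y = cycle g x" using cycle_eq[OF \<open>bij g\<close> cyc] .
    show ?case
    proof (cases "?y = ?a")
      case True
      have "descent g ?y \<in> cycle g x" using cyc[of "Suc m"] by simp
      then have "?a \<le> descent g ?y" by (rule Least_le)
      moreover have "descent g ?y \<le> ?y" by (simp add: descent_def)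
      ultimately show ?thesis using True by simp
    next
      case False
      then have "descent g ?y < ?y" using descent_less[OF g, of ?y] eq by simp
      then show ?thesis using Suc False by simp
    qed
  qed simp
  \<comment> \<open>After \<open>x\<close> steps the second alternative forces the value 0, which is
    then the least element too.\<close>
  from this[of x] show ?thesis
    using cyc[of x] Least_le[of "\<lambda>a. a \<in> cycle g x" "(descent g ^^ x) x"] by auto
qed

lemma urec_descent:
  assumes "\<And>g. g \<in> D \<Longrightarrow> bij g" "urec D n A"
  shows "urec D n (\<lambda>\<phi> xs. descent \<phi> (A \<phi> xs))"
proof (rule urec_unary[where b=descent, OF _ assms(2)])
  \<comment> \<open>The inverse is computed by searching for a preimage; surjectivity makes the
    search end.\<close>
  have "urec D 1 (\<lambda>\<phi> xs. LEAST z. \<phi> z = xs ! 0)"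
    using assms(1) by (intro urec_Least urec_eq urec_oracle urec_nth urec_nth_drop) (auto, metis bij_pointE)
  then have "urec D 1 (\<lambda>\<phi> xs. inv \<phi> (xs ! 0))"
  proof (rule urec_cong)
    fix \<phi> :: "nat \<Rightarrow> nat" and xs :: "nat list" assume "\<phi> \<in> D"
    then have "\<phi> z = xs ! 0 \<longleftrightarrow> z = inv \<phi> (xs ! 0)" for z
      using assms(1) bij_inv_eq_iff by metis
    then show "(LEAST z. \<phi> z = xs ! 0) = inv \<phi> (xs ! 0)" by (simp add: Least_equality)
  qed
  moreover have min: "min a b = a - (a - b)" for a b :: nat by simp
  ultimately show "urec D 1 (\<lambda>\<phi> zs. descent \<phi> (zs ! 0))"
    unfolding descent_def min by (intro urec_diff urec_oracle urec_nth) auto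
qed

text \<open>Taking all normal permutations as oracles yields one template for all of them, which is
  the uniformity required of the decider.\<close>

lemma urec_same_cycle: "urec {g. normal g} 2 (\<lambda>\<phi> xs. of_bool (xs ! 1 \<in> cycle \<phi> (xs ! 0)))"
proof -
  have "urec {g. normal g} 2
      (\<lambda>\<phi> xs. of_bool ((descent \<phi> ^^ (xs ! 0)) (xs ! 0) = (descent \<phi> ^^ (xs ! 1)) (xs ! 1)))"
    by (intro urec_eq urec_funpow urec_descent urec_nth) (auto simp: normal_def)
  then show ?thesis
  proof (rule urec_cong)
    fix g xs assume "g \<in> {g. normal g}"
    then have g: "normal g" "bij g" by (auto simp: normal_def)
    have least: "(LEAST a. a \<in> cycle g x) \<in> cycle g x" for x
      using self_in_cycle by (rule LeastI)
    have "(LEAST a. a \<in> cycle g x) = (LEAST a. a \<in> cycle g y) \<longleftrightarrow> y \<in> cycle g x" for x y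
      using least[of x] least[of y] cycle_eq[OF g(2)] self_in_cycle by metis
    then show "of_bool ((descent g ^^ (xs ! 0)) (xs ! 0) = (descent g ^^ (xs ! 1)) (xs ! 1))
      = (of_bool (xs ! 1 \<in> cycle g (xs ! 0)) :: nat)"
      by (simp add: funpow_descent[OF g(1)])
  qed
qed

text \<open>The oracle is the normal form, which is normal and has the same cycles as
  \<open>f\<close>.\<close>

lemma uniform_decider:
  "\<exists>T. template T \<and> (\<forall>f p. bij f \<longrightarrow> computes p (normal_form f) \<longrightarrow> decides_Part (T p) f)"
proof -
  obtain T where T: "template T" "\<And>g p xs. normal g \<Longrightarrow> computes p g \<Longrightarrow> length xs = 2 \<Longrightarrow>
    run (T p) xs = Some (of_bool (xs ! 1 \<in> cycle g (xs ! 0)))"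
    using urec_same_cycle unfolding urec_def by blast
  have "decides_Part (T p) f" if f: "bij f" and p: "computes p (normal_form f)" for f p
    unfolding decides_Part_def
  proof (intro allI)
    fix x y
    have "run (T p) [x, y] = Some (of_bool (y \<in> cycle (canonical f) x))"
      using T(2)[OF normal_canonical[OF f], of p "[x, y]"] p
      by (simp add: normal_form_eq_canonical[OF f])
    then show "run (T p) [x, y] = Some (if y \<in> cycle f x then 1 else 0)"
      by (simp add: cycle_canonical[OF f])
  qed
  with T(1) show ?thesis by blast
qed

theorem theorem3p12:
  shows "(\<forall>f\<in>rec_perms.
            decidable_Part f \<longleftrightarrow>
              recursive (normal_form f) \<and> effectively_conjugate f (normal_form f)) \<and>
         (\<exists>\<Phi>. recursive \<Phi> \<and>
            (\<forall>f\<in>rec_perms. \<forall>p. computes p (normal_form f) \<longrightarrow>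
               (\<exists>q. \<Phi> (goedel_number p) = goedel_number q \<and> decides_Part q f)))"
proof (intro conjI ballI iffI)
  fix f assume "f \<in> rec_perms"
  then obtain p where f: "bij f" and p: "computes p f" by (auto simp: rec_perms_def recursive_def)
  {
    assume "decidable_Part f"
    then obtain q where q: "decides_Part q f" unfolding decidable_Part_def by blast
    show "recursive (normal_form f)"
      unfolding normal_form_eq_canonical[OF f] recursive_iff_urec[OF p] by (rule urec_canonical[OF f q])
    have "recursive (conjugator f)"
      unfolding recursive_iff_urec[OF p] by (rule urec_conjugator[OF f q])
    then show "effectively_conjugate f (normal_form f)"
      unfolding effectively_conjugate_def normal_form_eq_canonical[OF f]
      using bij_conjugator[OF f] conjugate_canonical[OF f] by (auto simp: rec_perms_def)
  next
    assume "recursive (normal_form f) \<and> effectively_conjugate f (normal_form f)"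
    then show "decidable_Part f"
      using uniform_decider f unfolding recursive_def decidable_Part_def by blast
  }
next
  \<comment> \<open>\<open>T\<close>, and hence the function on Goedel numbers, is chosen before
    \<open>f\<close> and \<open>p\<close>.\<close>
  obtain T where T: "template T" "\<And>f p. bij f \<Longrightarrow> computes p (normal_form f) \<Longrightarrow> decides_Part (T p) f"
    using uniform_decider by blast
  obtain \<Phi> where "recursive \<Phi>" "\<And>p. \<Phi> (goedel_number p) = goedel_number (T p)"
    using template_goedel_number[OF T(1)] by blast
  then show "\<exists>\<Phi>. recursive \<Phi> \<and>
            (\<forall>f\<in>rec_perms. \<forall>p. computes p (normal_form f) \<longrightarrow>
               (\<exists>q. \<Phi> (goedel_number p) = goedel_number q \<and> decides_Part q f))"
    using T(2) by (intro exI[of _ \<Phi>]) (auto simp: rec_perms_def)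
qed

end
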